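(* Let $P$ be a stochastic matrix over the finite set $X = X^o \cup \partial X$ satisfying properties (i), (ii), (iii) listed in the context, let $n\ge 1$ be an integer, and let $g_1,\dots,g_n:\partial X\to\mathbb{C}$ be given boundary functions. For $\lambda\in\mathrm{res}(P_{X^o})$, the Riquier problem of order $n$ (defined in the context) with boundary functions $g_1,\dots,g_n$ has a unique solution $f=f_1$, and it is given by $$f(x)=\sum_{r=1}^n\bigl[\mathbf{G}(\lambda)^r\,Q\,g_r\bigr](x),\qquad x\in X^o,$$ where $\mathbf{G}(\lambda)^r$ is the $r$-th matrix power of $\mathbf{G}(\lambda)=(\lambda\cdot I_{X^o}-P_{X^o})^{-1}$.
   Context: $X$ is a finite set, the disjoint union of two non-empty subsets $X^o$ (the interior) and $\partial X$ (the boundary). $P = (p(x,y))_{x,y\in X}$ is a stochastic matrix (non-negative entries, row sums $1$), and $p^{(n)}(x,y)$ denotes the $(x,y)$-entry of $P^n$. The standing assumptions are: (i) for every $x\in X^o$ there is $w\in\partial X$ with $p^{(n)}(x,w)>0$ for some $n$; (ii) for every $w\in\partial X$, $p(w,w)=1$, and thus $p(w,x)=0$ for all $x\in X\setminus\{w\}$; (iii) for every $w\in\partial X$ there is $x\in X^o$ with $p^{(n)}(x,w)>0$ for some $n$. $P_{X^o}$ and $Q$ are the restrictions of $P$ to $X^o\times X^o$ and $X^o\times\partial X$, respectively; $I_{X^o}$ is the identity matrix over $X^o$; $\mathrm{res}(P_{X^o})=\mathbb{C}\setminus\mathrm{spec}(P_{X^o})$ is the complement of the set of eigenvalues of $P_{X^o}$.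 The $\lambda$-Laplacian is the $X\times X$-matrix given in block form (with respect to $X=X^o\cup\partial X$) by $$\Delta_\lambda=\begin{pmatrix}\lambda\cdot I_{X^o}-P_{X^o} & -Q\\ 0&0\end{pmatrix}.$$ For $f:X\to\mathbb{C}$ write $f^o=f|_{X^o}$ and $\Delta_\lambda^o f=(\Delta_\lambda f)|_{X^o}$. Riquier problem of order $n$: given $g_1,\dots,g_n:\partial X\to\mathbb{C}$, find a function $f:X\to\mathbb{C}$ for which there are functions $f_n,f_{n-1},\dots,f_1=f:X\to\mathbb{C}$ such that $f_r|_{\partial X}=g_r$ for $r=1,\dots,n$, $\Delta_\lambda^o f_n=0$, and $\Delta_\lambda^o f_r=f_{r+1}^o$ for $r=n-1,n-2,\dots,1$. *)

theory Defs
  imports "HOL-Analysis.Analysis"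
begin

(* The finite set X is the sum type 'i + 'b of two finite (and, being types, non-empty) types:
   Inl x are the interior points, Inr w the boundary points. Functions on X, on the interior and
   on the boundary are vectors indexed by the respective type. *)

(* Powers are defined here because ( * ) and (^) on the vector type are componentwise. *)
primrec matpow :: "'a::semiring_1^'n^'n \<Rightarrow> nat \<Rightarrow> 'a^'n^'n" where
  "matpow A 0 = mat 1"
| "matpow A (Suc k) = A ** matpow A k"

definition stochastic :: "real^'n^'n \<Rightarrow> bool" where
  "stochastic P \<longleftrightarrow> (\<forall>x y. P $ x $ y \<ge> 0) \<and> (\<forall>x. (\<Sum>y\<in>UNIV. P $ x $ y) = 1)"

definition spec :: "complex^'n^'n \<Rightarrow> complex set" where
  "spec A = {\<mu>. \<exists>v. v \<noteq> 0 \<and> A *v v = \<mu> *s v}"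

definition res :: "complex^'n^'n \<Rightarrow> complex set" where
  "res A = - spec A"

definition interior_block :: "real^('i::finite + 'b::finite)^('i + 'b) \<Rightarrow> complex^'i^'i" where
  "interior_block P = (\<chi> x y. complex_of_real (P $ Inl x $ Inl y))"

definition boundary_block :: "real^('i::finite + 'b::finite)^('i + 'b) \<Rightarrow> complex^'b^'i" where
  "boundary_block P = (\<chi> x w. complex_of_real (P $ Inl x $ Inr w))"

definition interior_part :: "'a^('i::finite + 'b::finite) \<Rightarrow> 'a^'i" where
  "interior_part f = (\<chi> x. f $ Inl x)"

definition boundary_part :: "'a^('i::finite + 'b::finite) \<Rightarrow> 'a^'b" where
  "boundary_part f = (\<chi> w. f $ Inr w)"

definition block_matrix ::
  "'a^'i::finite^'i \<Rightarrow> 'a^'b::finite^'i \<Rightarrow> 'a^'i^'b \<Rightarrow> 'a^'b^'b \<Rightarrow> 'a^('i + 'b)^('i + 'b)" where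
  "block_matrix A B C D = (\<chi> u v. case u of
      Inl x \<Rightarrow> (case v of Inl y \<Rightarrow> A $ x $ y | Inr z \<Rightarrow> B $ x $ z)
    | Inr w \<Rightarrow> (case v of Inl y \<Rightarrow> C $ w $ y | Inr z \<Rightarrow> D $ w $ z))"

definition laplacian :: "real^('i::finite + 'b::finite)^('i + 'b) \<Rightarrow> complex \<Rightarrow> complex^('i + 'b)^('i + 'b)"
  where
  "laplacian P \<mu> = block_matrix (mat \<mu> - interior_block P) (- boundary_block P) 0 0"

definition laplacian_interior ::
  "real^('i::finite + 'b::finite)^('i + 'b) \<Rightarrow> complex \<Rightarrow> complex^('i + 'b) \<Rightarrow> complex^'i" where
  "laplacian_interior P \<mu> f = interior_part (laplacian P \<mu> *v f)"

definition green :: "real^('i::finite + 'b::finite)^('i + 'b) \<Rightarrow> complex \<Rightarrow> complex^'i^'i" where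
  "green P \<mu> = matrix_inv (mat \<mu> - interior_block P)"

(* Only the values g r and F r with r in {1..n} matter. *)
definition riquier_solution ::
  "real^('i::finite + 'b::finite)^('i + 'b) \<Rightarrow> complex \<Rightarrow> nat \<Rightarrow> (nat \<Rightarrow> complex^'b)
     \<Rightarrow> complex^('i + 'b) \<Rightarrow> bool" where
  "riquier_solution P \<mu> n g f \<longleftrightarrow>
     (\<exists>F :: nat \<Rightarrow> complex^('i + 'b).
        F 1 = f \<and>
        (\<forall>r\<in>{1..n}. boundary_part (F r) = g r) \<and>
        laplacian_interior P \<mu> (F n) = 0 \<and>
        (\<forall>r\<in>{1..<n}. laplacian_interior P \<mu> (F r) = interior_part (F (r + 1))))"

end

theory Submission
  imports Defs
begin

text \<open>
  On the interior, the condition $\Delta_\lambda^o f_r = f_{r+1}^o$ (with $f_{n+1}^o = 0$) reads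
  $(\lambda I - P_{X^o}) f_r^o = Q g_r + f_{r+1}^o$. Since $\lambda I - P_{X^o}$ is invertible, this
  determines $f_n^o, f_{n-1}^o, \dots, f_1^o$ one after the other, and unrolling the recursion gives
  the formula.
\<close>

lemma mat_mult_vec: "mat c *v v = c *s (v :: 'a::comm_semiring_1^'n)"
  by (simp add: vec_eq_iff mat_def matrix_vector_mult_def if_distrib if_distribR cong: if_cong)

text \<open>A nonzero kernel vector of \<open>mat \<mu> - A\<close> would be an eigenvector of
  \<open>A\<close> for \<open>\<mu>\<close>. A square matrix with trivial kernel has a left inverse,
  which is then two-sided.\<close>

lemma res_imp_invertible:
  fixes A :: "complex^'n^'n"
  assumes "\<mu> \<in> res A"
  shows "invertible (mat \<mu> - A)"
proof -
  have "v = 0" if "(mat \<mu> - A) *v v = 0" for v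
    using assms that
    by (auto simp: res_def spec_def matrix_vector_mult_diff_rdistrib mat_mult_vec)
  then show ?thesis
    by (simp add: invertible_left_inverse matrix_left_invertible_ker)
qed

lemma invertible_mult_vec_eq_iff:
  fixes A :: "'a::field^'n^'n"
  assumes "invertible A"
  shows "A *v u = v \<longleftrightarrow> u = matrix_inv A *v v"
proof -
  \<comment> \<open>\<open>matrix_inv\<close> is a Hilbert choice, so its defining equations hold
    only once some inverse is known to exist.\<close>
  have "A ** matrix_inv A = mat 1 \<and> matrix_inv A ** A = mat 1"
    using someI_ex[OF assms[unfolded invertible_def]] by (simp add: matrix_inv_def)
  then show ?thesis
    by (metis matrix_vector_mul_assoc matrix_vector_mul_lid)
qed

lemma laplacian_interior_eq:
  "laplacian_interior P \<mu> f =
     (mat \<mu> - interior_block P) *v interior_part f - boundary_block P *v boundary_part f"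
proof -
  have sum_Plus: "(\<Sum>u\<in>UNIV. h u) = (\<Sum>x\<in>UNIV. h (Inl x)) + (\<Sum>w\<in>UNIV. h (Inr w))"
    for h :: "'a + 'b \<Rightarrow> complex"
    using sum.Plus[of "UNIV :: 'a set" "UNIV :: 'b set" h] by simp
  show ?thesis
    by (simp add: vec_eq_iff laplacian_interior_def interior_part_def boundary_part_def
        laplacian_def block_matrix_def matrix_vector_mult_def sum_Plus sum_negf)
qed

lemma vec_sum_eq_iff:
  "f = h \<longleftrightarrow> interior_part f = interior_part h \<and> boundary_part f = boundary_part h"
  by (simp add: vec_eq_iff interior_part_def boundary_part_def split_sum_all)

text \<open>Closed form of the unrolled recursion for the interior part of the r-th function. Each
  level from \<open>s\<close> down to \<open>r\<close> applies \<open>green P \<mu>\<close> once,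
  which makes \<open>s - r + 1\<close> factors.\<close>

definition riquier_interior ::
  "real^('i::finite + 'b::finite)^('i + 'b) \<Rightarrow> complex \<Rightarrow> nat \<Rightarrow> (nat \<Rightarrow> complex^'b)
     \<Rightarrow> nat \<Rightarrow> complex^'i" where
  "riquier_interior P \<mu> n g r =
     (\<Sum>s = r..n. matpow (green P \<mu>) (Suc s - r) *v (boundary_block P *v g s))"

text \<open>This empty sum lets the condition on the last function be treated as one more instance
  of the recursion.\<close>

lemma riquier_interior_Suc_self: "riquier_interior P \<mu> n g (Suc n) = 0"
  by (simp add: riquier_interior_def)

lemma riquier_interior_step:
  assumes "r \<le> n"
  shows "riquier_interior P \<mu> n g r =
    green P \<mu> *v (boundary_block P *v g r + riquier_interior P \<mu> n g (Suc r))"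
proof -
  have "riquier_interior P \<mu> n g r = green P \<mu> *v (boundary_block P *v g r) +
      (\<Sum>s = Suc r..n. matpow (green P \<mu>) (Suc s - r) *v (boundary_block P *v g s))"
    unfolding riquier_interior_def using assms by (simp add: sum.atLeast_Suc_atMost)
  also have "(\<Sum>s = Suc r..n. matpow (green P \<mu>) (Suc s - r) *v (boundary_block P *v g s)) =
      (\<Sum>s = Suc r..n. green P \<mu> *v
        (matpow (green P \<mu>) (Suc s - Suc r) *v (boundary_block P *v g s)))"
    \<comment> \<open>For \<open>s \<ge> Suc r\<close> the exponent \<open>Suc s - r\<close> is the
      successor of \<open>Suc s - Suc r\<close>, so one factor \<open>green P \<mu>\<close> splits
      off on the left.\<close>
    by (intro sum.cong) (auto simp: Suc_diff_le matrix_vector_mul_assoc matrix_mul_assoc)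
  also have "\<dots> = green P \<mu> *v riquier_interior P \<mu> n g (Suc r)"
    unfolding riquier_interior_def
    by (rule linear_sum[OF matrix_vector_mul_linear, symmetric])
  finally show ?thesis
    by (simp add: matrix_vector_right_distrib)
qed

lemma riquier_solution_iff:
  assumes "n \<ge> 1" and "\<mu> \<in> res (interior_block P)"
  shows "riquier_solution P \<mu> n g f \<longleftrightarrow>
    interior_part f = riquier_interior P \<mu> n g 1 \<and> boundary_part f = g 1"
proof -
  let ?u = "riquier_interior P \<mu> n g"
  have laplacian_iff: "laplacian_interior P \<mu> h = v \<longleftrightarrow>
      interior_part h = green P \<mu> *v (boundary_block P *v boundary_part h + v)" for h v
    using invertible_mult_vec_eq_iff[OF res_imp_invertible[OF assms(2)]]
    by (simp add: laplacian_interior_eq green_def diff_eq_eq add.commute)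
  show ?thesis
  proof
    assume "riquier_solution P \<mu> n g f"
    then obtain F where F: "F 1 = f" "\<forall>r\<in>{1..n}. boundary_part (F r) = g r"
        "laplacian_interior P \<mu> (F n) = 0"
        "\<forall>r\<in>{1..<n}. laplacian_interior P \<mu> (F r) = interior_part (F (r + 1))"
      unfolding riquier_solution_def by blast
    \<comment> \<open>Downward induction from \<open>n\<close>. The guard \<open>1 \<le> r\<close>
      is needed because \<open>F 0\<close> is unconstrained.\<close>
    have "1 \<le> r \<longrightarrow> interior_part (F r) = ?u r" if "r \<le> n" for r
      using that
    proof (induction r rule: inc_induct)
      case base
      then show ?case
        using F(2,3) riquier_interior_step[of n n P \<mu> g]
        by (simp add: laplacian_iff riquier_interior_Suc_self)
    next
      case (step r)
      then show ?case
        using F(2,4) riquier_interior_step[of r n P \<mu> g] by (simp add: laplacian_iff)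
    qed
    then show "interior_part f = ?u 1 \<and> boundary_part f = g 1"
      using F(1,2) assms(1) by auto
  next
    assume f: "interior_part f = ?u 1 \<and> boundary_part f = g 1"
    \<comment> \<open>The closed form inside is glued to the prescribed data on the
      boundary.\<close>
    define F where "F r = (\<chi> v. case v of Inl x \<Rightarrow> ?u r $ x | Inr w \<Rightarrow> g r $ w)" for r
    have F: "interior_part (F r) = ?u r" "boundary_part (F r) = g r" for r
      by (simp_all add: F_def interior_part_def boundary_part_def)
    \<comment> \<open>The case \<open>r = n\<close> is included: there the right-hand side is 0, as
      the last equation demands.\<close>
    have "laplacian_interior P \<mu> (F r) = ?u (Suc r)" if "r \<le> n" for r
      using riquier_interior_step[OF that, of P \<mu> g] by (simp add: laplacian_iff F)
    moreover have "F 1 = f"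
      using f by (simp add: vec_sum_eq_iff F)
    ultimately show "riquier_solution P \<mu> n g f"
      unfolding riquier_solution_def
      by (intro exI[of _ F]) (simp add: F riquier_interior_Suc_self)
  qed
qed

theorem mainTheorem8:
  fixes P :: "real^('i::finite + 'b::finite)^('i + 'b)"
    and \<mu> :: complex
    and n :: nat
    and g :: "nat \<Rightarrow> complex^'b"
  assumes "stochastic P"
    and "\<forall>x::'i. \<exists>w::'b. \<exists>k. matpow P k $ Inl x $ Inr w > 0"
    and "\<forall>w::'b. P $ Inr w $ Inr w = 1"
    and "\<forall>w::'b. \<exists>x::'i. \<exists>k. matpow P k $ Inl x $ Inr w > 0"
    and "n \<ge> 1"
    and "\<mu> \<in> res (interior_block P)"
  shows "(\<exists>!f. riquier_solution P \<mu> n g f) \<and>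
    (\<forall>f. riquier_solution P \<mu> n g f \<longrightarrow>
      (\<forall>x::'i. f $ Inl x =
        (\<Sum>r = 1..n. (matpow (green P \<mu>) r *v (boundary_block P *v g r)) $ x)))"
proof -
  let ?f = "\<chi> v. case v of Inl x \<Rightarrow> riquier_interior P \<mu> n g 1 $ x | Inr w \<Rightarrow> g 1 $ w"
  note iff = riquier_solution_iff[OF assms(5,6)]
  have "riquier_solution P \<mu> n g ?f"
    by (simp add: iff interior_part_def boundary_part_def)
  moreover have "f = h" if "riquier_solution P \<mu> n g f" "riquier_solution P \<mu> n g h" for f h
    using that by (simp add: iff vec_sum_eq_iff)
  \<comment> \<open>At \<open>r = 1\<close> the exponent \<open>Suc s - 1\<close> in
    \<open>riquier_interior\<close> is just \<open>s\<close>.\<close>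
  moreover have "f $ Inl x =
      (\<Sum>r = 1..n. (matpow (green P \<mu>) r *v (boundary_block P *v g r)) $ x)"
    if "riquier_solution P \<mu> n g f" for f x
    using that by (simp add: iff interior_part_def riquier_interior_def vec_eq_iff)
  ultimately show ?thesis
    by blast
qed

end
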